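(* Let $T:H(\mathbb{C})\rightarrow H(\mathbb{C})$ be a continuous linear operator that satisfies the following conditions: (1) $\ker T\neq\{0\}$; (2) there is a constant $a\in\mathbb{C}\setminus\{0\}$ such that $\left[T,\frac{\mathrm{d}}{\mathrm{d}z}\right]=aI$, where $I$ is the identity operator on $H(\mathbb{C})$. Then $T$ is hypercyclic.
   Context: $H(\mathbb{C})$ is the space of all entire functions on $\mathbb{C}$ with the topology of uniform convergence on compact subsets of $\mathbb{C}$. For linear operators $A,B$ on $H(\mathbb{C})$, $[A,B]=AB-BA$; $\frac{\mathrm{d}}{\mathrm{d}z}$ is the differentiation operator $f\mapsto f'$ on $H(\mathbb{C})$. A continuous linear operator $T:X\to X$ on a topological vector space $X$ is called hypercyclic if there exists $x\in X$ such that the orbit $\{T^nx : n=0,1,2,\dots\}$ is dense in $X$. *)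

theory Defs
  imports "HOL-Complex_Analysis.Complex_Analysis"
begin

section \<open>The space of entire functions\<close>

typedef entire = "{f :: complex \<Rightarrow> complex. f holomorphic_on UNIV}"
  morphisms entire_apply Entire
  by (rule exI[of _ "\<lambda>_. 0"]) auto

setup_lifting type_definition_entire

lemma entire_apply_holomorphic: "entire_apply f holomorphic_on UNIV"
  using entire_apply[of f] by simp

instantiation entire :: ab_group_add
begin

lift_definition zero_entire :: entire is "\<lambda>_. 0" by simp
lift_definition plus_entire :: "entire \<Rightarrow> entire \<Rightarrow> entire" is "\<lambda>f g z. f z + g z"
  by (rule holomorphic_on_add)
lift_definition minus_entire :: "entire \<Rightarrow> entire \<Rightarrow> entire" is "\<lambda>f g z. f z - g z"
  by (rule holomorphic_on_diff)
lift_definition uminus_entire :: "entire \<Rightarrow> entire" is "\<lambda>f z. - f z"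
  by (rule holomorphic_on_minus)

instance
  by (standard; transfer) (auto simp: fun_eq_iff)

end

lift_definition entire_scale :: "complex \<Rightarrow> entire \<Rightarrow> entire" is "\<lambda>c f z. c * f z"
  by (intro holomorphic_intros)

lift_definition entire_deriv :: "entire \<Rightarrow> entire" is deriv
  by (rule holomorphic_deriv) auto

interpretation entire: vector_space entire_scale
  by (standard; transfer) (auto simp: fun_eq_iff algebra_simps)

lemma linear_entire_deriv: "Vector_Spaces.linear entire_scale entire_scale entire_deriv"
proof
  fix f g :: entire and c :: complex
  show "entire_deriv (f + g) = entire_deriv f + entire_deriv g"
    by transfer (auto simp: fun_eq_iff holomorphic_on_imp_differentiable_at)
  show "entire_deriv (entire_scale c f) = entire_scale c (entire_deriv f)"
    by transfer (auto simp: fun_eq_iff holomorphic_on_imp_differentiable_at)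
qed


section \<open>Uniform convergence on compact subsets\<close>

definition entire_nbhd :: "entire \<Rightarrow> complex set \<Rightarrow> real \<Rightarrow> entire set" where
  "entire_nbhd f K e = {g. \<forall>z\<in>K. dist (entire_apply g z) (entire_apply f z) < e}"

instantiation entire :: topological_space
begin

definition open_entire :: "entire set \<Rightarrow> bool" where
  "open_entire U \<longleftrightarrow> (\<forall>f\<in>U. \<exists>K e. compact K \<and> e > 0 \<and> entire_nbhd f K e \<subseteq> U)"

instance
proof
  show "open (UNIV :: entire set)"
    unfolding open_entire_def using compact_empty zero_less_one by blast
next
  fix S T :: "entire set"
  assume ST: "open S" "open T"
  show "open (S \<inter> T)"
    unfolding open_entire_def
  proof
    fix f assume f: "f \<in> S \<inter> T"
    obtain K d where K: "compact K" "d > 0" "entire_nbhd f K d \<subseteq> S"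
      using ST(1) f unfolding open_entire_def by blast
    obtain L e where L: "compact L" "e > 0" "entire_nbhd f L e \<subseteq> T"
      using ST(2) f unfolding open_entire_def by blast
    have "entire_nbhd f (K \<union> L) (min d e) \<subseteq> entire_nbhd f K d \<inter> entire_nbhd f L e"
      by (auto simp: entire_nbhd_def)
    with K L show "\<exists>K e. compact K \<and> e > 0 \<and> entire_nbhd f K e \<subseteq> S \<inter> T"
      by (intro exI[of _ "K \<union> L"] exI[of _ "min d e"]) auto
  qed
next
  fix \<U> :: "entire set set"
  assume U: "\<forall>U\<in>\<U>. open U"
  show "open (\<Union>\<U>)"
    unfolding open_entire_def
  proof
    fix f assume "f \<in> \<Union>\<U>"
    then obtain V where V: "V \<in> \<U>" "f \<in> V" by blast
    have "open V" using U V(1) by (rule bspec)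
    then obtain K e where K: "compact K" "e > 0" "entire_nbhd f K e \<subseteq> V"
      using V(2) unfolding open_entire_def by blast
    have "entire_nbhd f K e \<subseteq> \<Union>\<U>"
      using K(3) V(1) by (rule order_trans[OF _ Union_upper])
    with K show "\<exists>K e. compact K \<and> e > 0 \<and> entire_nbhd f K e \<subseteq> \<Union>\<U>"
      by (intro exI conjI)
  qed
qed

end

lemma open_entire_nbhd:
  assumes K: "compact K"
  shows "open (entire_nbhd f K e)"
proof (cases "K = {}")
  case True
  then show ?thesis by (simp add: entire_nbhd_def)
next
  case False
  show ?thesis
    unfolding open_entire_def
  proof
    fix g assume g: "g \<in> entire_nbhd f K e"
    have "continuous_on K (\<lambda>z. dist (entire_apply g z) (entire_apply f z))"
      by (intro continuous_on_dist holomorphic_on_imp_continuous_on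
          holomorphic_on_subset[OF entire_apply_holomorphic]) auto
    from continuous_attains_sup[OF K False this] obtain w where w: "w \<in> K"
      "\<And>z. z \<in> K \<Longrightarrow> dist (entire_apply g z) (entire_apply f z)
                        \<le> dist (entire_apply g w) (entire_apply f w)"
      by blast
    define d where "d = e - dist (entire_apply g w) (entire_apply f w)"
    have "d > 0" using g w(1) by (simp add: d_def entire_nbhd_def)
    moreover have "entire_nbhd g K d \<subseteq> entire_nbhd f K e"
    proof
      fix h assume h: "h \<in> entire_nbhd g K d"
      have "dist (entire_apply h z) (entire_apply f z) < e" if "z \<in> K" for z
      proof -
        have "dist (entire_apply h z) (entire_apply g z) < d"
          using h that by (simp add: entire_nbhd_def)
        then show ?thesis
          using w(2)[OF that]
            dist_triangle[of "entire_apply h z" "entire_apply f z" "entire_apply g z"]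
          by (simp add: d_def)
      qed
      then show "h \<in> entire_nbhd f K e" by (simp add: entire_nbhd_def)
    qed
    ultimately show "\<exists>K' e'. compact K' \<and> e' > 0 \<and> entire_nbhd g K' e' \<subseteq> entire_nbhd f K e"
      using K by blast
  qed
qed

lemma tendsto_entire_iff:
  "(f \<longlongrightarrow> l) F \<longleftrightarrow>
     (\<forall>K. compact K \<longrightarrow> uniform_limit K (\<lambda>i. entire_apply (f i)) (entire_apply l) F)"
proof (intro iffI allI impI)
  fix K :: "complex set" assume lim: "(f \<longlongrightarrow> l) F" and K: "compact K"
  show "uniform_limit K (\<lambda>i. entire_apply (f i)) (entire_apply l) F"
  proof (rule uniform_limitI)
    fix e :: real assume "e > 0"
    then have "l \<in> entire_nbhd l K e" by (simp add: entire_nbhd_def)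
    from topological_tendstoD[OF lim open_entire_nbhd[OF K] this]
    show "\<forall>\<^sub>F i in F. \<forall>z\<in>K. dist (entire_apply (f i) z) (entire_apply l z) < e"
      by (simp add: entire_nbhd_def)
  qed
next
  assume unif: "\<forall>K. compact K \<longrightarrow>
    uniform_limit K (\<lambda>i. entire_apply (f i)) (entire_apply l) F"
  show "(f \<longlongrightarrow> l) F"
  proof (rule topological_tendstoI)
    fix U assume "open U" "l \<in> U"
    then obtain K e where K: "compact K" "e > 0" "entire_nbhd l K e \<subseteq> U"
      unfolding open_entire_def by blast
    have "\<forall>\<^sub>F i in F. \<forall>z\<in>K. dist (entire_apply (f i) z) (entire_apply l z) < e"
      using unif K by (auto intro: uniform_limitD)
    then show "\<forall>\<^sub>F i in F. f i \<in> U"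
      by eventually_elim (use K(3) in \<open>auto simp: entire_nbhd_def\<close>)
  qed
qed

lemma tendsto_entire_add:
  fixes f g :: "'a \<Rightarrow> entire"
  assumes "(f \<longlongrightarrow> l) F" "(g \<longlongrightarrow> m) F"
  shows "((\<lambda>i. f i + g i) \<longlongrightarrow> l + m) F"
  using assms by (simp add: tendsto_entire_iff plus_entire.rep_eq uniform_limit_add)

lemma tendsto_entire_scale:
  assumes c: "(c \<longlongrightarrow> b) F" and f: "(f \<longlongrightarrow> l) F"
  shows "((\<lambda>i. entire_scale (c i) (f i)) \<longlongrightarrow> entire_scale b l) F"
  unfolding tendsto_entire_iff entire_scale.rep_eq
proof (intro allI impI)
  fix K :: "complex set" assume K: "compact K"
  have "bounded (entire_apply l ` K)"
    by (intro compact_imp_bounded compact_continuous_image K holomorphic_on_imp_continuous_on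
        holomorphic_on_subset[OF entire_apply_holomorphic]) auto
  moreover have "uniform_limit K (\<lambda>i _. c i) (\<lambda>_. b) F"
    by (rule uniform_limitI) (rule eventually_mono[OF tendstoD[OF c]], auto)
  moreover have "uniform_limit K (\<lambda>i. entire_apply (f i)) (entire_apply l) F"
    using f K by (simp add: tendsto_entire_iff)
  moreover have "bounded ((\<lambda>_. b) ` K)"
    by (simp add: image_constant_conv)
  ultimately show "uniform_limit K (\<lambda>i z. c i * entire_apply (f i) z)
                     (\<lambda>z. b * entire_apply l z) F"
    by (intro uniform_lim_mult)
qed

instance entire :: topological_ab_group_add
proof
  fix a b :: entire
  show "((\<lambda>x. fst x + snd x) \<longlongrightarrow> a + b) (nhds a \<times>\<^sub>F nhds b)"
    by (intro tendsto_entire_add filterlim_fst filterlim_snd)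
  have "uniform_limit K (\<lambda>f z. - entire_apply f z) (\<lambda>z. - entire_apply a z) (nhds a)"
    if "compact K" for K
    using that tendsto_ident_at tendsto_entire_iff[of "\<lambda>f. f" a "nhds a"]
    by (intro uniform_limit_uminus) (auto simp: filterlim_ident)
  then show "(uminus \<longlongrightarrow> - a) (nhds a)"
    by (simp add: tendsto_entire_iff uminus_entire.rep_eq)
qed


section \<open>Commutators and hypercyclic operators\<close>

definition commutator :: "('a::ab_group_add \<Rightarrow> 'a) \<Rightarrow> ('a \<Rightarrow> 'a) \<Rightarrow> 'a \<Rightarrow> 'a" where
  "commutator A B = (\<lambda>x. A (B x) - B (A x))"

definition hypercyclic ::
  "('k::field \<Rightarrow> 'a \<Rightarrow> 'a) \<Rightarrow> ('a::{ab_group_add, topological_space} \<Rightarrow> 'a) \<Rightarrow> bool" where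
  "hypercyclic smul T \<longleftrightarrow>
     Vector_Spaces.linear smul smul T \<and> continuous_on UNIV T \<and>
     (\<exists>x. closure (range (\<lambda>n. (T ^^ n) x)) = UNIV)"

end

theory Submission
  imports Defs
begin

text \<open>Let \<open>D\<close> be differentiation and \<open>f \<noteq> 0\<close> in the kernel of \<open>T\<close>. The commutator relation gives
  \<open>T (D^(n+1) f) = (n+1) a D^n f\<close>, so \<open>T\<close> is a backward shift along \<open>u n = D^n f / (n! a^n)\<close>, a
  sequence tending to \<open>0\<close>. If the span of the \<open>D^n f\<close> is dense, an explicit series
  of shifted linear combinations of the \<open>u n\<close> is a hypercyclic vector.

  Density: the closure \<open>E\<close> of the span is invariant under \<open>D\<close>. The translate
  \<open>f (w + \<cdot>) = \<Sum> w^n D^n f / n!\<close> is an eigenvector of \<open>T\<close> for the eigenvalue \<open>a w\<close>; on the other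
  hand \<open>f (w + \<cdot>) = \<Sum> (D^n f) w z^n / n!\<close>, so that evaluating \<open>T (f (w + \<cdot>))\<close> at \<open>0\<close> exhibits
  \<open>w \<mapsto> a w f w\<close> as an element of \<open>E\<close>. Hence \<open>E\<close> is closed under multiplication by \<open>z\<close>, i.e. a
  closed ideal. Being invariant under \<open>D\<close> it has no common zero, so the zeros of \<open>f\<close> in a disc can
  be divided out inside \<open>E\<close>, and approximating the reciprocal of the quotient by polynomials
  yields \<open>1 \<in> E\<close>.\<close>

subsection \<open>Uniform convergence of Taylor expansions\<close>

text \<open>Cauchy's inequality on circles of radius \<open>t\<close> about \<open>w\<close> bounds
  the \<open>n\<close>-th term by \<open>B * (s / t) ^ n\<close>, so the M-test applies. Uniformity
  in centre and increment jointly allows either one to be frozen later.\<close>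

lemma uniform_limit_taylor:
  fixes f :: "complex \<Rightarrow> complex"
  assumes f: "f holomorphic_on ball 0 \<rho>" and rs: "0 \<le> r" "0 \<le> s" "r + s < \<rho>"
  shows "uniform_limit (cball 0 r \<times> cball 0 s)
           (\<lambda>N (w, z). \<Sum>n<N. (deriv ^^ n) f w / fact n * z ^ n) (\<lambda>(w, z). f (w + z)) sequentially"
proof -
  \<comment> \<open>The midpoint of \<open>s\<close> and \<open>\<rho> - r\<close>: the ratio
    \<open>s / t\<close> is below 1, while closed discs of radius \<open>t\<close> about points of
    \<open>cball 0 r\<close> stay inside \<open>ball 0 \<rho>\<close>.\<close>
  define t where "t = (s + (\<rho> - r)) / 2"
  have t: "s < t" "0 < t" "r + t < \<rho>"
    using rs by (auto simp: t_def field_simps)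
  have "continuous_on (cball 0 (r + t)) f"
    by (intro holomorphic_on_imp_continuous_on holomorphic_on_subset[OF f]) (use t in auto)
  then have "bounded (f ` cball 0 (r + t))"
    by (intro compact_imp_bounded compact_continuous_image) auto
  then obtain B where "\<forall>y\<in>f ` cball 0 (r + t). norm y \<le> B"
    unfolding bounded_iff ..
  then have B: "norm (f x) \<le> B" if "x \<in> cball 0 (r + t)" for x
    using that by simp
  have sub: "cball w t \<subseteq> cball 0 (r + t)" if "w \<in> cball 0 r" for w :: complex
  proof
    fix x assume "x \<in> cball w t"
    with that norm_triangle_sub[of x w] show "x \<in> cball 0 (r + t)"
      by (simp add: dist_norm norm_minus_commute)
  qed
  have der: "norm ((deriv ^^ n) f w) \<le> fact n * B / t ^ n" if w: "w \<in> cball 0 r" for n w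
  proof (rule Cauchy_inequality)
    have *: "cball w t \<subseteq> ball 0 \<rho>"
      using sub[OF w] t by auto
    then show "f holomorphic_on ball w t"
      using ball_subset_cball[of w t] by (blast intro: holomorphic_on_subset[OF f])
    show "continuous_on (cball w t) f"
      by (rule holomorphic_on_imp_continuous_on[OF holomorphic_on_subset[OF f *]])
    show "norm (f x) \<le> B" if "norm (w - x) = t" for x
      using sub[OF w] that by (intro B) (auto simp: dist_norm subset_iff)
  qed (use t in auto)
  have "uniform_limit (cball 0 r \<times> cball 0 s)
          (\<lambda>N x. \<Sum>n<N. (deriv ^^ n) f (fst x) / fact n * snd x ^ n)
          (\<lambda>x. \<Sum>n. (deriv ^^ n) f (fst x) / fact n * snd x ^ n) sequentially"
  proof (rule Weierstrass_m_test)
    show "norm ((deriv ^^ n) f (fst x) / fact n * snd x ^ n) \<le> B * (s / t) ^ n"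
      if "x \<in> cball 0 r \<times> cball 0 s" for n x
    proof -
      have B0: "0 \<le> B"
        using order_trans[OF norm_ge_zero B[of 0]] rs t by simp
      have "norm ((deriv ^^ n) f (fst x) / fact n * snd x ^ n)
              = norm ((deriv ^^ n) f (fst x)) / fact n * norm (snd x) ^ n"
        by (simp add: norm_mult norm_divide norm_power)
      also have "\<dots> \<le> (fact n * B / t ^ n) / fact n * s ^ n"
        using der[of "fst x" n] that t rs B0
        by (intro mult_mono divide_right_mono power_mono) (simp_all add: mem_Times_iff)
      finally show ?thesis
        by (simp add: power_divide)
    qed
    show "summable (\<lambda>n. B * (s / t) ^ n)"
      using t rs by (intro summable_mult summable_geometric) auto
  qed
  moreover have "(\<Sum>n. (deriv ^^ n) f w / fact n * z ^ n) = f (w + z)"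
    if "w \<in> cball 0 r" "z \<in> cball 0 s" for w z
  proof -
    have "cball (0 :: complex) (r + t) \<subseteq> ball 0 \<rho>"
      using t by auto
    then have "ball w t \<subseteq> ball 0 \<rho>"
      using ball_subset_cball[of w t] sub[OF that(1)] by blast
    then have "f holomorphic_on ball w t"
      by (rule holomorphic_on_subset[OF f])
    moreover have "w + z \<in> ball w t"
      using that t by (simp add: dist_norm)
    ultimately have "(\<lambda>n. (deriv ^^ n) f w / fact n * (w + z - w) ^ n) sums f (w + z)"
      by (rule holomorphic_power_series)
    then show ?thesis
      by (simp add: sums_iff)
  qed
  ultimately show ?thesis
    by (subst uniform_limit_cong'[where g = "\<lambda>N x. \<Sum>n<N. (deriv ^^ n) f (fst x) / fact n * snd x ^ n"
          and i = "\<lambda>x. \<Sum>n. (deriv ^^ n) f (fst x) / fact n * snd x ^ n"])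
       (auto simp: case_prod_unfold)
qed

subsection \<open>The topological ring of entire functions\<close>

lemma entire_eqI: "(\<And>z. entire_apply f z = entire_apply g z) \<Longrightarrow> f = g"
  by (simp add: entire_apply_inject[symmetric] fun_eq_iff)

instantiation entire :: comm_ring_1
begin

lift_definition one_entire :: entire is "\<lambda>_. 1" by simp
lift_definition times_entire :: "entire \<Rightarrow> entire \<Rightarrow> entire" is "\<lambda>f g z. f z * g z"
  by (rule holomorphic_on_mult)

instance
  by (standard; transfer) (auto simp: fun_eq_iff algebra_simps)

end

lift_definition entire_const :: "complex \<Rightarrow> entire" is "\<lambda>c _. c" by simp
lift_definition entire_var :: entire is "\<lambda>z. z" by (rule holomorphic_on_ident)

lemmas entire_rep = zero_entire.rep_eq plus_entire.rep_eq minus_entire.rep_eq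
  uminus_entire.rep_eq one_entire.rep_eq times_entire.rep_eq entire_scale.rep_eq
  entire_deriv.rep_eq entire_const.rep_eq entire_var.rep_eq

lemma entire_apply_sum: "entire_apply (sum f A) z = (\<Sum>i\<in>A. entire_apply (f i) z)"
  by (induction A rule: infinite_finite_induct) (auto simp: entire_rep)

lemma entire_apply_power: "entire_apply (f ^ n) z = entire_apply f z ^ n"
  by (induction n) (auto simp: entire_rep)

lemma entire_apply_of_nat: "entire_apply (of_nat n) = (\<lambda>_. of_nat n)"
  by (induction n) (auto simp: entire_rep)

lemma entire_apply_higher_deriv: "entire_apply ((entire_deriv ^^ n) f) = (deriv ^^ n) (entire_apply f)"
  by (induction n) (auto simp: entire_rep)

lemma entire_scale_eq_mult: "entire_scale c f = entire_const c * f"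
  by (rule entire_eqI) (simp add: entire_rep)

lemma field_differentiable_entire_apply: "entire_apply f field_differentiable (at z)"
  using entire_apply_holomorphic holomorphic_on_imp_differentiable_at by blast

lemma continuous_on_entire_apply: "continuous_on A (entire_apply f)"
  by (intro holomorphic_on_imp_continuous_on holomorphic_on_subset[OF entire_apply_holomorphic]) auto

lemma entire_deriv_mult: "entire_deriv (f * g) = entire_deriv f * g + f * entire_deriv g"
  by (rule entire_eqI) (simp add: entire_rep field_differentiable_entire_apply)

lemma entire_deriv_add: "entire_deriv (f + g) = entire_deriv f + entire_deriv g"
  by (rule entire_eqI) (simp add: entire_rep field_differentiable_entire_apply)

lemma entire_deriv_diff: "entire_deriv (f - g) = entire_deriv f - entire_deriv g"
  by (rule entire_eqI) (simp add: entire_rep field_differentiable_entire_apply)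

lemma entire_deriv_const: "entire_deriv (entire_const c) = 0"
  by (rule entire_eqI) (simp add: entire_rep)

lemma entire_deriv_var: "entire_deriv entire_var = 1"
  by (rule entire_eqI) (simp add: entire_rep)

text \<open>Leibniz's rule breaks off after two terms because the second derivative of
  \<open>l\<close> vanishes. It serves for \<open>z - c\<close> when zeros are divided out and for
  \<open>z\<close> itself in the final theorem.\<close>

lemma higher_entire_deriv_linear_mult:
  assumes "entire_deriv l = 1"
  shows "(entire_deriv ^^ Suc n) (l * f)
           = l * (entire_deriv ^^ Suc n) f + of_nat (Suc n) * (entire_deriv ^^ n) f"
proof (induction n)
  case 0
  show ?case by (simp add: entire_deriv_mult assms)
next
  case (Suc n)
  have "entire_deriv (of_nat k :: entire) = 0" for k
    by (rule entire_eqI) (simp add: entire_rep entire_apply_of_nat)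
  with Suc show ?case
    by (simp add: entire_deriv_mult entire_deriv_add assms algebra_simps del: of_nat_Suc)
       (simp add: algebra_simps)
qed

section \<open>Limits and closures under uniform convergence on compact sets\<close>

lemma tendsto_entire_apply:
  assumes "(f \<longlongrightarrow> l) F"
  shows "((\<lambda>i. entire_apply (f i) z) \<longlongrightarrow> entire_apply l z) F"
proof -
  have "uniform_limit {z} (\<lambda>i. entire_apply (f i)) (entire_apply l) F"
    using assms[unfolded tendsto_entire_iff, rule_format, of "{z}"] by simp
  then show ?thesis
    by (rule tendsto_uniform_limitI) simp
qed

lemma compact_subset_cball_0:
  fixes K :: "'a::real_normed_vector set"
  assumes "compact K"
  obtains r where "0 \<le> r" "K \<subseteq> cball 0 r"
proof -
  obtain r where "0 < r" "\<And>x. x \<in> K \<Longrightarrow> norm x \<le> r"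
    using compact_imp_bounded[OF assms] unfolding bounded_pos by blast
  then show ?thesis
    by (intro that[of r]) auto
qed

lemma tendsto_entire_cballI:
  assumes "\<And>r. 0 \<le> r \<Longrightarrow> uniform_limit (cball 0 r) (\<lambda>i. entire_apply (f i)) (entire_apply l) F"
  shows "(f \<longlongrightarrow> l) F"
  unfolding tendsto_entire_iff
proof (intro allI impI)
  fix K :: "complex set" assume "compact K"
  then obtain r where "0 \<le> r" "K \<subseteq> cball 0 r"
    by (rule compact_subset_cball_0)
  with assms[of r] show "uniform_limit K (\<lambda>i. entire_apply (f i)) (entire_apply l) F"
    by (auto intro: uniform_limit_on_subset)
qed

lemma tendsto_entire_mult:
  fixes f g :: "'a \<Rightarrow> entire"
  assumes "(f \<longlongrightarrow> l) F" "(g \<longlongrightarrow> m) F"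
  shows "((\<lambda>i. f i * g i) \<longlongrightarrow> l * m) F"
  unfolding tendsto_entire_iff times_entire.rep_eq
proof (intro allI impI)
  fix K :: "complex set" assume K: "compact K"
  have "bounded (entire_apply h ` K)" for h
    by (intro compact_imp_bounded compact_continuous_image K continuous_on_entire_apply)
  then show "uniform_limit K (\<lambda>i z. entire_apply (f i) z * entire_apply (g i) z)
               (\<lambda>z. entire_apply l z * entire_apply m z) F"
    using assms K by (intro uniform_lim_mult) (auto simp: tendsto_entire_iff)
qed

lemma tendsto_entire_sum:
  fixes f :: "'a \<Rightarrow> 'b \<Rightarrow> entire"
  assumes "\<And>i. i \<in> I \<Longrightarrow> (f i \<longlongrightarrow> l i) F"
  shows "((\<lambda>x. \<Sum>i\<in>I. f i x) \<longlongrightarrow> (\<Sum>i\<in>I. l i)) F"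
  using assms by (induction I rule: infinite_finite_induct) (auto intro: tendsto_entire_add)

text \<open>By Cauchy's inequality on unit circles, the derivative on \<open>cball 0 r\<close> is
  controlled by the function on \<open>cball 0 (r + 1)\<close>. Halving \<open>e\<close> turns the
  non-strict bound into a strict one.\<close>

lemma tendsto_entire_deriv:
  assumes "(f \<longlongrightarrow> l) F"
  shows "((\<lambda>i. entire_deriv (f i)) \<longlongrightarrow> entire_deriv l) F"
proof (rule tendsto_entire_cballI, rule uniform_limitI)
  fix r e :: real assume r: "0 \<le> r" and e: "0 < e"
  have "uniform_limit (cball 0 (r + 1)) (\<lambda>i. entire_apply (f i)) (entire_apply l) F"
    using assms by (simp add: tendsto_entire_iff)
  then have "\<forall>\<^sub>F i in F. \<forall>z\<in>cball 0 (r + 1). dist (entire_apply (f i) z) (entire_apply l z) < e / 2"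
    using e by (intro uniform_limitD) auto
  then show "\<forall>\<^sub>F i in F. \<forall>z\<in>cball 0 r.
      dist (entire_apply (entire_deriv (f i)) z) (entire_apply (entire_deriv l) z) < e"
  proof eventually_elim
    case (elim i)
    show ?case
    proof
      fix z :: complex assume z: "z \<in> cball 0 r"
      have "norm ((deriv ^^ 1) (entire_apply (f i - l)) z) \<le> fact 1 * (e / 2) / 1 ^ 1"
      proof (rule Cauchy_inequality)
        fix x assume x: "norm (z - x) = 1"
        then have "x \<in> cball 0 (r + 1)"
          using z norm_triangle_sub[of x z] by (simp add: norm_minus_commute)
        with elim have "dist (entire_apply (f i) x) (entire_apply l x) < e / 2"
          by blast
        then show "norm (entire_apply (f i - l) x) \<le> e / 2"
          by (simp add: entire_rep dist_norm)
      qed (auto intro: continuous_on_entire_apply holomorphic_on_subset[OF entire_apply_holomorphic])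
      then have "norm (entire_apply (entire_deriv (f i - l)) z) \<le> e / 2"
        by (simp add: entire_deriv.rep_eq)
      then show "dist (entire_apply (entire_deriv (f i)) z) (entire_apply (entire_deriv l) z) < e"
        using e by (simp add: entire_deriv_diff dist_norm minus_entire.rep_eq)
    qed
  qed
qed

lemma closure_entire_iff:
  "f \<in> closure A \<longleftrightarrow>
     (\<forall>r\<ge>0. \<forall>e>0. \<exists>g\<in>A. \<forall>z\<in>cball 0 r. dist (entire_apply g z) (entire_apply f z) < e)"
    (is "_ \<longleftrightarrow> ?P")
proof
  assume f: "f \<in> closure A"
  show ?P
  proof (intro allI impI)
    fix r e :: real assume "0 \<le> r" and e: "0 < e"
    have "open (entire_nbhd f (cball 0 r) e)" "f \<in> entire_nbhd f (cball 0 r) e"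
      using e open_entire_nbhd[OF compact_cball] by (auto simp: entire_nbhd_def)
    with f have "A \<inter> entire_nbhd f (cball 0 r) e \<noteq> {}"
      by (meson closure_iff_nhds_not_empty subset_refl)
    then show "\<exists>g\<in>A. \<forall>z\<in>cball 0 r. dist (entire_apply g z) (entire_apply f z) < e"
      by (auto simp: entire_nbhd_def)
  qed
next
  assume P: ?P
  show "f \<in> closure A"
    unfolding closure_iff_nhds_not_empty
  proof (intro allI impI)
    fix B S assume S: "S \<subseteq> B" "open S" "f \<in> S"
    then obtain K e where K: "compact K" "e > 0" "entire_nbhd f K e \<subseteq> S"
      unfolding open_entire_def by blast
    obtain r where r: "0 \<le> r" "K \<subseteq> cball 0 r"
      using K(1) by (rule compact_subset_cball_0)
    from P K(2) r(1) obtain g where "g \<in> A"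
      "\<forall>z\<in>cball 0 r. dist (entire_apply g z) (entire_apply f z) < e"
      by blast
    then have "g \<in> entire_nbhd f K e" "g \<in> A"
      using r by (auto simp: entire_nbhd_def)
    with K(3) S(1) show "A \<inter> B \<noteq> {}" by blast
  qed
qed

lemma continuous_on_tendstoI:
  fixes f :: "'a::topological_space \<Rightarrow> 'b::topological_space"
  assumes "\<And>l. (f \<longlongrightarrow> f l) (at l within S)"
  shows "continuous_on S f"
  using assms by (simp add: continuous_on_def)

lemma subspace_closure_entire:
  assumes "entire.subspace A"
  shows "entire.subspace (closure A)"
proof -
  have image: "h f \<in> closure A"
    if h: "continuous_on UNIV h" and A: "\<And>f. f \<in> A \<Longrightarrow> h f \<in> closure A" and f: "f \<in> closure A" for h f
  proof -
    have "h ` closure A \<subseteq> closure A"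
      by (rule image_closure_subset[OF continuous_on_subset[OF h]]) (use A in auto)
    with f show ?thesis by blast
  qed
  \<comment> \<open>The summands are moved into the closure one after the other: first the right
    one, with the left one still in \<open>A\<close>, then the left one.\<close>
  have add: "f + g \<in> closure A" if f: "f \<in> A" and g: "g \<in> closure A" for f g
  proof (rule image[OF _ _ g])
    show "f + h \<in> closure A" if "h \<in> A" for h
      using entire.subspace_add[OF assms f that] closure_subset by blast
  qed (intro continuous_intros)
  have add': "f + g \<in> closure A" if f: "f \<in> closure A" and g: "g \<in> closure A" for f g
  proof (rule image[OF _ _ f])
    show "h + g \<in> closure A" if "h \<in> A" for h
      using add[OF that g] .
  qed (intro continuous_intros)
  have scale: "entire_scale c f \<in> closure A" if f: "f \<in> closure A" for c f
  proof (rule image[OF _ _ f])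
    show "continuous_on UNIV (entire_scale c)"
      by (rule continuous_on_tendstoI, rule tendsto_entire_scale[OF tendsto_const tendsto_ident_at])
    show "entire_scale c h \<in> closure A" if "h \<in> A" for h
      using entire.subspace_scale[OF assms that] closure_subset by blast
  qed
  have "0 \<in> closure A"
    using entire.subspace_0[OF assms] closure_subset by blast
  with add' scale show ?thesis
    by (simp add: entire.subspace_def)
qed

subsection \<open>Closed ideals invariant under differentiation\<close>

lemma tendsto_entire_taylor:
  "(\<lambda>N. \<Sum>n<N. entire_scale ((deriv ^^ n) (entire_apply h) 0 / fact n) (entire_var ^ n)) \<longlonglongrightarrow> h"
proof (rule tendsto_entire_cballI)
  fix s :: real assume s: "0 \<le> s"
  have "uniform_limit (cball 0 0 \<times> cball 0 s)
      (\<lambda>N (w, z). \<Sum>n<N. (deriv ^^ n) (entire_apply h) w / fact n * z ^ n)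
      (\<lambda>(w, z). entire_apply h (w + z)) sequentially"
    using s by (intro uniform_limit_taylor[where \<rho> = "s + 1"])
      (auto intro: holomorphic_on_subset[OF entire_apply_holomorphic])
  \<comment> \<open>The degenerate disc \<open>cball 0 0\<close> of centres freezes the expansion at
    the origin.\<close>
  from uniform_limit_compose'[OF this, of "Pair 0" "cball 0 s"]
  show "uniform_limit (cball 0 s) (\<lambda>N. entire_apply
      (\<Sum>n<N. entire_scale ((deriv ^^ n) (entire_apply h) 0 / fact n) (entire_var ^ n)))
      (entire_apply h) sequentially"
    by (simp add: entire_apply_sum[abs_def] entire_rep entire_apply_power Pi_def)
qed

text \<open>Iterating \<open>var\<close> gives all polynomial multiples of \<open>f\<close>; the
  Taylor polynomials of \<open>h\<close> and closedness do the rest.\<close>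

lemma closed_ideal_entireI:
  assumes E: "closed E" "entire.subspace E"
    and var: "\<And>f. f \<in> E \<Longrightarrow> entire_var * f \<in> E"
    and f: "f \<in> E"
  shows "h * f \<in> E"
proof -
  have pow: "entire_var ^ n * f \<in> E" for n
    by (induction n) (auto simp: f mult.assoc intro: var)
  have "(\<Sum>n<N. entire_scale (c n) (entire_var ^ n)) * f \<in> E" for N and c :: "nat \<Rightarrow> complex"
    unfolding sum_distrib_right
  proof (rule entire.subspace_sum[OF E(2)])
    fix n
    have "entire_scale (c n) (entire_var ^ n) * f = entire_scale (c n) (entire_var ^ n * f)"
      by (simp add: entire_scale_eq_mult mult.assoc)
    then show "entire_scale (c n) (entire_var ^ n) * f \<in> E"
      using entire.subspace_scale[OF E(2) pow] by simp
  qed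
  then show ?thesis
    by (intro Lim_in_closed_set[OF E(1) _ _ tendsto_entire_mult[OF tendsto_entire_taylor tendsto_const]])
       auto
qed

text \<open>The difference quotient of \<open>f\<close> at \<open>c\<close> has a removable
  singularity there.\<close>

lemma entire_factor:
  obtains q where "f = entire_const (entire_apply f c) + (entire_var - entire_const c) * q"
proof -
  define q where "q = (\<lambda>z. if z = c then deriv (entire_apply f) c
                           else (entire_apply f z - entire_apply f c) / (z - c))"
  have "q holomorphic_on UNIV"
    unfolding q_def by (intro pole_lemma_open entire_apply_holomorphic) auto
  then have "entire_apply (Entire q) = q"
    by (simp add: Entire_inverse)
  then have "f = entire_const (entire_apply f c) + (entire_var - entire_const c) * Entire q"
    by (intro entire_eqI) (simp add: entire_rep q_def)
  then show ?thesis by (rule that)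
qed

text \<open>Identity theorem. It is the reason why a nonzero ideal invariant under differentiation
  has no common zero.\<close>

lemma entire_higher_deriv_nonzero:
  assumes "f \<noteq> 0"
  obtains n where "entire_apply ((entire_deriv ^^ n) f) z \<noteq> 0"
proof -
  have "\<exists>n. (deriv ^^ n) (entire_apply f) z \<noteq> 0"
  proof (rule ccontr)
    assume "\<nexists>n. (deriv ^^ n) (entire_apply f) z \<noteq> 0"
    then have "entire_apply f w = 0" for w
      using holomorphic_fun_eq_0_on_connected[OF entire_apply_holomorphic[of f] open_UNIV connected_UNIV]
      by auto
    with assms show False
      by (auto intro: entire_eqI simp: entire_rep)
  qed
  with that show ?thesis
    by (auto simp: entire_apply_higher_deriv)
qed

context
  fixes E :: "entire set"
  assumes closed: "closed E" and subspace: "entire.subspace E"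
    and var: "\<And>f. f \<in> E \<Longrightarrow> entire_var * f \<in> E"
    and deriv: "\<And>f. f \<in> E \<Longrightarrow> entire_deriv f \<in> E"
begin

lemma mult_mem: "f \<in> E \<Longrightarrow> h * f \<in> E"
  by (rule closed_ideal_entireI[OF closed subspace var])

lemma higher_deriv_mem: "f \<in> E \<Longrightarrow> (entire_deriv ^^ n) f \<in> E"
  by (induction n) (auto intro: deriv)

text \<open>An element \<open>h\<close> of the ideal with \<open>h c = 1\<close> allows to divide by \<open>z - c\<close>: if
  \<open>h = 1 + (z - c) k\<close>, then \<open>q = h q - k (z - c) q\<close>.\<close>

lemma divide_mem:
  assumes g: "(entire_var - entire_const c) * q \<in> E" and f: "f \<in> E" "f \<noteq> 0"
  shows "q \<in> E"
proof -
  obtain n where n: "entire_apply ((entire_deriv ^^ n) f) c \<noteq> 0"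
    using f(2) by (rule entire_higher_deriv_nonzero)
  define h where "h = entire_const (1 / entire_apply ((entire_deriv ^^ n) f) c) * (entire_deriv ^^ n) f"
  have h: "h \<in> E"
    unfolding h_def by (intro mult_mem higher_deriv_mem f)
  have "entire_apply h c = 1"
    using n by (simp add: h_def entire_rep)
  then obtain k where k: "h = entire_const 1 + (entire_var - entire_const c) * k"
    using entire_factor[of h c] by metis
  have "entire_const 1 = 1"
    by (rule entire_eqI) (simp add: entire_rep)
  then have "q = q * h - k * ((entire_var - entire_const c) * q)"
    unfolding k by (simp add: algebra_simps)
  moreover have "q * h \<in> E" "k * ((entire_var - entire_const c) * q) \<in> E"
    by (intro mult_mem h g)+
  ultimately show ?thesis
    using entire.subspace_diff[OF subspace] by metis
qed

text \<open>Induction on a bound \<open>n\<close> for the order of the zero at \<open>c\<close>: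
  division by \<open>z - c\<close> lowers the bound by one, stays in \<open>E\<close> by
  \<open>divide_mem\<close>, and does not affect zeros elsewhere.\<close>

lemma remove_zero:
  assumes "g \<in> E" "entire_apply ((entire_deriv ^^ n) g) c \<noteq> 0"
  shows "\<exists>q\<in>E. entire_apply q c \<noteq> 0 \<and> (\<forall>z. z \<noteq> c \<longrightarrow> entire_apply q z = 0 \<longleftrightarrow> entire_apply g z = 0)"
  using assms
proof (induction n arbitrary: g)
  case 0
  then show ?case by auto
next
  case (Suc n)
  let ?l = "entire_var - entire_const c"
  show ?case
  proof (cases "entire_apply g c = 0")
    case False
    with Suc.prems show ?thesis by blast
  next
    case True
    obtain q where "g = entire_const (entire_apply g c) + ?l * q"
      by (rule entire_factor)
    moreover have "entire_const 0 = 0"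
      by (rule entire_eqI) (simp add: entire_rep)
    ultimately have q: "g = ?l * q"
      using True by simp
    have "g \<noteq> 0"
    proof
      assume "g = 0"
      then have "entire_apply ((entire_deriv ^^ m) g) = (\<lambda>_. 0)" for m
        by (induction m) (auto simp: entire_rep)
      with Suc.prems(2) show False by metis
    qed
    with Suc.prems q have "q \<in> E"
      by (intro divide_mem[of c q g]) auto
    moreover have "entire_deriv ?l = 1"
      by (simp add: entire_deriv_diff entire_deriv_var entire_deriv_const)
    \<comment> \<open>The factor \<open>z - c\<close> vanishes at \<open>c\<close>, so only the
      second Leibniz term survives and the \<open>n\<close>-th derivative of \<open>q\<close> is
      nonzero there.\<close>
    then have "entire_apply ((entire_deriv ^^ Suc n) g) c
                 = of_nat (Suc n) * entire_apply ((entire_deriv ^^ n) q) c"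
      unfolding q higher_entire_deriv_linear_mult[OF \<open>entire_deriv ?l = 1\<close>]
      by (simp add: plus_entire.rep_eq times_entire.rep_eq minus_entire.rep_eq entire_var.rep_eq
          entire_const.rep_eq entire_apply_of_nat del: of_nat_Suc funpow.simps)
    with Suc.prems(2) have "entire_apply ((entire_deriv ^^ n) q) c \<noteq> 0"
      by auto
    ultimately obtain p where p: "p \<in> E" "entire_apply p c \<noteq> 0"
      "\<And>z. z \<noteq> c \<Longrightarrow> entire_apply p z = 0 \<longleftrightarrow> entire_apply q z = 0"
      using Suc.IH by blast
    have "entire_apply q z = 0 \<longleftrightarrow> entire_apply g z = 0" if "z \<noteq> c" for z
      using that by (simp add: q entire_rep)
    with p show ?thesis by blast
  qed
qed

text \<open>The zeros in the disc are finitely many, and \<open>remove_zero\<close> strips them off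
  point by point, multiplicities included.\<close>

lemma zero_free_mem:
  assumes f: "f \<in> E" "f \<noteq> 0"
  obtains g where "g \<in> E" "\<And>z. z \<in> cball 0 s \<Longrightarrow> entire_apply g z \<noteq> 0"
proof -
  have *: "\<exists>q\<in>E. \<forall>z\<in>cball 0 s. entire_apply q z \<noteq> 0"
    if "finite Z" "g \<in> E" "g \<noteq> 0" "{z \<in> cball 0 s. entire_apply g z = 0} = Z" for g Z
    using that
  proof (induction Z arbitrary: g rule: finite_induct)
    case empty
    then show ?case by blast
  next
    case (insert c Z)
    obtain n where n: "entire_apply ((entire_deriv ^^ n) g) c \<noteq> 0"
      using insert.prems(2) by (rule entire_higher_deriv_nonzero)
    from remove_zero[OF insert.prems(1) n] obtain q where q: "q \<in> E" "entire_apply q c \<noteq> 0"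
      "\<And>z. z \<noteq> c \<Longrightarrow> entire_apply q z = 0 \<longleftrightarrow> entire_apply g z = 0"
      by blast
    have "{z \<in> cball 0 s. entire_apply q z = 0} = {z \<in> cball 0 s. entire_apply g z = 0} - {c}"
    proof (intro set_eqI)
      show "z \<in> {z \<in> cball 0 s. entire_apply q z = 0} \<longleftrightarrow>
              z \<in> {z \<in> cball 0 s. entire_apply g z = 0} - {c}" for z
        using q(2) q(3)[of z] by (cases "z = c") auto
    qed
    with insert have "{z \<in> cball 0 s. entire_apply q z = 0} = Z"
      by auto
    moreover have "q \<noteq> 0"
      using q(2) by (auto simp: entire_rep)
    ultimately show ?case
      using insert.IH q(1) by blast
  qed
  have "finite {z \<in> cball 0 s. entire_apply f z = 0}"
  \<comment> \<open>Finiteness of the zeros in a compact set is available for nonconstant functions;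
    a nonzero constant has none.\<close>
  proof (cases "entire_apply f constant_on UNIV")
    case True
    then obtain b where b: "\<And>z. entire_apply f z = b"
      by (auto simp: constant_on_def)
    with f(2) have "b \<noteq> 0"
      by (auto intro: entire_eqI simp: entire_rep)
    with b show ?thesis by simp
  next
    case False
    show ?thesis
      by (rule holomorphic_compact_finite_zeros[OF entire_apply_holomorphic _ _ _ _ False]) auto
  qed
  from *[OF this f refl] show ?thesis
    using that by blast
qed

lemma deriv_invariant_closed_ideal_eq_UNIV:
  assumes f: "f \<in> E" "f \<noteq> 0"
  shows "E = UNIV"
proof -
  have "1 \<in> closure E"
    unfolding closure_entire_iff
  proof (intro allI impI)
    fix r e :: real assume r: "0 \<le> r" and e: "0 < e"
    \<comment> \<open>The extra radius makes \<open>1 / g\<close> holomorphic on an open disc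
      containing \<open>cball 0 r\<close>, where its Taylor polynomials \<open>p N\<close> converge
      uniformly. That \<open>g\<close> depends on \<open>r\<close> is harmless, since the closure is
      tested disc by disc.\<close>
    obtain g where g: "g \<in> E" "\<And>z. z \<in> cball 0 (r + 1) \<Longrightarrow> entire_apply g z \<noteq> 0"
      using zero_free_mem[OF f, of "r + 1"] by blast
    define F where "F = (\<lambda>z. 1 / entire_apply g z)"
    define p where "p N = (\<Sum>n<N. entire_scale ((deriv ^^ n) F 0 / fact n) (entire_var ^ n))" for N
    have "F holomorphic_on ball 0 (r + 1)"
      unfolding F_def using g(2)
      by (intro holomorphic_on_divide holomorphic_on_const
          holomorphic_on_subset[OF entire_apply_holomorphic]) auto
    then have "uniform_limit (cball 0 0 \<times> cball 0 r)
        (\<lambda>N (w, z). \<Sum>n<N. (deriv ^^ n) F w / fact n * z ^ n) (\<lambda>(w, z). F (w + z)) sequentially"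
      using r by (intro uniform_limit_taylor[where \<rho> = "r + 1"]) auto
    from uniform_limit_compose'[OF this, of "Pair 0" "cball 0 r"]
    have "uniform_limit (cball 0 r) (\<lambda>N. entire_apply (p N)) F sequentially"
      by (simp add: p_def entire_apply_sum[abs_def] entire_rep entire_apply_power Pi_def)
    moreover have bdd: "bounded (entire_apply g ` cball 0 r)"
      by (intro compact_imp_bounded compact_continuous_image continuous_on_entire_apply) auto
    moreover have "bounded (F ` cball 0 r)"
      unfolding F_def using g(2)
      by (intro compact_imp_bounded compact_continuous_image continuous_intros
          continuous_on_entire_apply) auto
    ultimately have "uniform_limit (cball 0 r) (\<lambda>N z. entire_apply (p N) z * entire_apply g z)
        (\<lambda>z. F z * entire_apply g z) sequentially"
      by (intro uniform_lim_mult uniform_limit_const)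
    from uniform_limitD[OF this e] obtain N where
      "\<forall>z\<in>cball 0 r. dist (entire_apply (p N) z * entire_apply g z) (F z * entire_apply g z) < e"
      by (auto simp: eventually_sequentially)
    moreover have "F z * entire_apply g z = 1" if "z \<in> cball 0 r" for z
      using g(2)[of z] that by (simp add: F_def)
    ultimately have "\<forall>z\<in>cball 0 r. dist (entire_apply (p N * g) z) (entire_apply 1 z) < e"
      by (simp add: entire_rep)
    moreover have "p N * g \<in> E"
      by (intro mult_mem g)
    ultimately show "\<exists>g\<in>E. \<forall>z\<in>cball 0 r. dist (entire_apply g z) (entire_apply 1 z) < e"
      by blast
  qed
  with closed have "1 \<in> E" by simp
  then have "h \<in> E" for h
    using mult_mem[of 1 h] by simp
  then show ?thesis by blast
qed

end

subsection \<open>Backward shifts along a null sequence\<close>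

text \<open>On a fixed disc of radius \<open>r\<close> the bound holds for all
  \<open>k \<ge> r\<close>, so the eventual form of the M-test applies; a locally uniform limit of
  entire functions is entire.\<close>

lemma entire_convergent_series:
  assumes v: "\<And>k z. z \<in> cball 0 (real k) \<Longrightarrow> norm (entire_apply (v k) z) \<le> (1 / 2) ^ k"
  obtains x where "(\<lambda>N. \<Sum>k<N. v k) \<longlonglongrightarrow> x"
proof -
  define X where "X z = (\<Sum>k. entire_apply (v k) z)" for z
  have unif: "uniform_limit (cball 0 r) (\<lambda>N z. \<Sum>k<N. entire_apply (v k) z) X sequentially" for r
    unfolding X_def
  proof (rule Weierstrass_m_test_ev)
    have "\<forall>z\<in>cball 0 r. norm (entire_apply (v k) z) \<le> (1 / 2) ^ k" if "nat \<lceil>r\<rceil> \<le> k" for k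
    proof
      fix z :: complex assume "z \<in> cball 0 r"
      moreover have "r \<le> real k" using that by linarith
      ultimately have "z \<in> cball 0 (real k)" by simp
      then show "norm (entire_apply (v k) z) \<le> (1 / 2) ^ k" by (rule v)
    qed
    then show "\<forall>\<^sub>F k in sequentially. \<forall>z\<in>cball 0 r. norm (entire_apply (v k) z) \<le> (1 / 2) ^ k"
      unfolding eventually_sequentially by blast
    show "summable (\<lambda>k. (1 / 2 :: real) ^ k)"
      by (rule summable_geometric) simp
  qed
  have "X holomorphic_on ball 0 r" for r
  proof (rule holomorphic_uniform_limit[OF _ unif[of r]])
    show "\<forall>\<^sub>F N in sequentially. continuous_on (cball 0 r) (\<lambda>z. \<Sum>k<N. entire_apply (v k) z) \<and>
            (\<lambda>z. \<Sum>k<N. entire_apply (v k) z) holomorphic_on ball 0 r"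
      by (intro always_eventually allI conjI continuous_on_sum holomorphic_on_sum
          continuous_on_entire_apply holomorphic_on_subset[OF entire_apply_holomorphic]) auto
  qed auto
  then have "X field_differentiable (at z)" for z
    using holomorphic_on_imp_differentiable_at[of X "ball 0 (norm z + 1)" z] by simp
  then have "X holomorphic_on UNIV"
    by (simp add: holomorphic_on_def)
  then have "entire_apply (Entire X) = X"
    by (simp add: Entire_inverse)
  then have "(\<lambda>N. \<Sum>k<N. v k) \<longlonglongrightarrow> Entire X"
    using unif by (intro tendsto_entire_cballI) (simp add: entire_apply_sum[abs_def])
  then show ?thesis by (rule that)
qed

lemma continuous_on_funpow:
  fixes f :: "'a::topological_space \<Rightarrow> 'a"
  assumes "continuous_on UNIV f"
  shows "continuous_on UNIV (f ^^ n)"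
proof (induction n)
  case (Suc n)
  have "continuous_on UNIV (\<lambda>x. f ((f ^^ n) x))"
    by (rule continuous_on_compose2[OF assms Suc]) simp
  then show ?case by (simp add: o_def)
qed (simp add: continuous_on_id)

lemma linear_funpow:
  assumes "Vector_Spaces.linear s s f"
  shows "Vector_Spaces.linear s s (f ^^ n)"
proof (induction n)
  case 0
  show ?case
    using assms by (auto simp: Vector_Spaces.linear_iff)
next
  case (Suc n)
  from Vector_Spaces.linear_compose[OF Suc assms] show ?case by (simp only: funpow.simps)
qed

lemma entire_span_range_sum:
  fixes u :: "nat \<Rightarrow> entire"
  assumes "x \<in> entire.span (range u)"
  obtains N c where "x = (\<Sum>i<N. entire_scale (c i) (u i))"
proof -
  \<comment> \<open>Asking for all \<open>M \<ge> N\<close> lets the sum be lengthened until it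
    reaches the index of the vector added in the induction step.\<close>
  have "\<exists>N c. \<forall>M\<ge>N. x = (\<Sum>i<M. entire_scale (c i) (u i))"
    using assms
  proof (induction rule: entire.span_induct_alt)
    case base
    have "\<forall>M\<ge>0. 0 = (\<Sum>i<M. entire_scale 0 (u i))" by simp
    then show ?case by (intro exI)
  next
    case (step a y x)
    then obtain N c where N: "\<And>M. N \<le> M \<Longrightarrow> x = (\<Sum>i<M. entire_scale (c i) (u i))" by blast
    from step obtain j where j: "y = u j" by blast
    define d where "d i = (if i = j then a else 0) + c i" for i
    have "entire_scale a y + x = (\<Sum>i<M. entire_scale (d i) (u i))" if "max N (Suc j) \<le> M" for M
    proof -
      have "(\<Sum>i<M. entire_scale (d i) (u i))
              = (\<Sum>i<M. if i = j then entire_scale a (u i) else 0) + (\<Sum>i<M. entire_scale (c i) (u i))"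
        unfolding sum.distrib[symmetric]
        by (rule sum.cong) (auto simp: d_def entire.scale_left_distrib)
      also have "\<dots> = entire_scale a y + x"
        using that N[of M] by (simp add: sum.delta j)
      finally show ?thesis by simp
    qed
    then show ?case by (intro exI allI impI)
  qed
  with that show ?thesis by blast
qed

lemma sum_half_powers_le: "(\<Sum>k=Suc j..<N. (1 / 2 :: real) ^ k) \<le> (1 / 2) ^ j"
proof (cases "Suc j \<le> N")
  case True
  then have "(\<Sum>k=Suc j..<N. (1 / 2 :: real) ^ k) = (1 / 2) ^ j - 2 * (1 / 2) ^ N"
    by (induction N rule: dec_induct) auto
  then show ?thesis by simp
qed simp

text \<open>In the manner of the hypercyclicity criterion: shifting the coefficients of a
  combination forward gives preimages under powers of \<open>T\<close> that tend to 0, while high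
  powers of \<open>T\<close> annihilate every combination.\<close>

lemma hypercyclic_backward_shift:
  fixes T :: "entire \<Rightarrow> entire" and u :: "nat \<Rightarrow> entire"
  assumes lin: "Vector_Spaces.linear entire_scale entire_scale T" and cont: "continuous_on UNIV T"
    and u0: "T (u 0) = 0" and uS: "\<And>n. T (u (Suc n)) = u n"
    and lim: "u \<longlonglongrightarrow> 0" and dense: "closure (entire.span (range u)) = UNIV"
  shows "hypercyclic entire_scale T"
proof -
  \<comment> \<open>Coefficients are kept as a list: lists over a countable set are countable, and
    the length tells which powers of \<open>T\<close> annihilate the combination.\<close>
  define V where "V k cs = (\<Sum>i<length cs. entire_scale (cs ! i) (u (k + i)))" for k cs
  have Tn: "(T ^^ n) (u m) = (if n \<le> m then u (m - n) else 0)" for n m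
  proof (induction n)
    case (Suc n)
    have "T 0 = 0"
      using lin by (metis linear_iff_module_hom module_hom.zero)
    then show ?case
      using Suc u0 uS[of "m - Suc n"] by (auto simp: Suc_diff_Suc le_Suc_eq not_le)
  qed simp
  have TV: "(T ^^ n) (V k cs) = (\<Sum>i<length cs. entire_scale (cs ! i) ((T ^^ n) (u (k + i))))" for n k cs
  proof -
    interpret Tn: Vector_Spaces.linear entire_scale entire_scale "T ^^ n"
      by (rule linear_funpow[OF lin])
    show ?thesis by (simp add: V_def Tn.sum Tn.scale)
  qed
  have TV_le: "(T ^^ n) (V k cs) = V (k - n) cs" if "n \<le> k" for n k cs
    using that unfolding TV by (simp add: Tn V_def)
  \<comment> \<open>The largest index occurring is \<open>k + length cs - 1\<close>, and
    \<open>T ^^ n\<close> annihilates \<open>u m\<close> as soon as \<open>n > m\<close>.\<close>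
  have TV_0: "(T ^^ n) (V k cs) = 0" if "k + length cs \<le> n" for n k cs
    using that unfolding TV by (intro sum.neutral) (auto simp: Tn)
  have V_lim: "(\<lambda>k. V k cs) \<longlonglongrightarrow> 0" for cs
  proof -
    have "(\<lambda>k. entire_scale (cs ! i) (u (k + i))) \<longlonglongrightarrow> 0" for i
      using tendsto_entire_scale[OF tendsto_const LIMSEQ_ignore_initial_segment[OF lim, of i]] by simp
    then show ?thesis
      unfolding V_def
      using tendsto_entire_sum[of "{..<length cs}" "\<lambda>i k. entire_scale (cs ! i) (u (k + i))" "\<lambda>_. 0"]
      by simp
  qed

  obtain D :: "complex set" where D: "countable D" "closure D = UNIV"
  proof -
    obtain D :: "complex set" where "countable D" "\<And>X. open X \<Longrightarrow> X \<noteq> {} \<Longrightarrow> \<exists>d\<in>D. d \<in> X"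
      using countable_dense_setE by blast
    then show ?thesis
      by (intro that[of D]) (auto simp: closure_iff_nhds_not_empty, blast)
  qed
  have closure_V: "closure (V 0 ` lists D) = UNIV"
  proof -
    have "x \<in> closure (V 0 ` lists D)" if "x \<in> entire.span (range u)" for x
    proof -
      from that obtain N c where x: "x = (\<Sum>i<N. entire_scale (c i) (u i))"
        by (rule entire_span_range_sum)
      have "\<exists>d. (\<forall>m. d m \<in> D) \<and> d \<longlonglongrightarrow> c i" for i
        using D(2) closure_sequential[of "c i" D] by auto
      then obtain d where d: "\<And>i m. d i m \<in> D" "\<And>i. d i \<longlonglongrightarrow> c i"
        by metis
      have "(\<lambda>m. \<Sum>i<N. entire_scale (d i m) (u i)) \<longlonglongrightarrow> x"
        unfolding x by (intro tendsto_entire_sum tendsto_entire_scale d tendsto_const)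
      moreover have "(\<Sum>i<N. entire_scale (d i m) (u i)) = V 0 (map (\<lambda>i. d i m) [0..<N])" for m
        by (simp add: V_def)
      ultimately have "(\<lambda>m. V 0 (map (\<lambda>i. d i m) [0..<N])) \<longlonglongrightarrow> x"
        by simp
      moreover have "V 0 (map (\<lambda>i. d i m) [0..<N]) \<in> closure (V 0 ` lists D)" for m
        using d(1) by (intro subsetD[OF closure_subset] imageI) auto
      ultimately show ?thesis
        by (intro Lim_in_closed_set[OF closed_closure]) auto
    qed
    then have "closure (entire.span (range u)) \<subseteq> closure (V 0 ` lists D)"
      by (intro closure_minimal) auto
    with dense show ?thesis by auto
  qed

  \<comment> \<open>Enumerates \<open>lists D\<close> so that every list recurs for arbitrarily
    large \<open>j\<close>: the second component of the decoded pair varies freely.\<close>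
  define y where "y j = from_nat_into (lists D) (fst (prod_decode j))" for j
  have y_surj: "\<exists>j\<ge>m. y j = cs" if "cs \<in> lists D" for cs m
  proof -
    have "cs \<in> range (from_nat_into (lists D))"
      using that D(1) by (subst range_from_nat_into) auto
    then obtain i where "cs = from_nat_into (lists D) i" by blast
    then have "y (prod_encode (i, m)) = cs" by (simp add: y_def)
    with le_prod_encode_2[of m i] show ?thesis by blast
  qed

  have "\<exists>M. \<forall>m\<ge>M. \<forall>z\<in>cball 0 (real k). norm (entire_apply (V m (y k)) z) \<le> (1 / 2) ^ k" for k
  proof -
    have "uniform_limit (cball 0 (real k)) (\<lambda>m. entire_apply (V m (y k))) (entire_apply 0) sequentially"
      using V_lim[of "y k", unfolded tendsto_entire_iff, rule_format, OF compact_cball] .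
    then have "\<forall>\<^sub>F m in sequentially. \<forall>z\<in>cball 0 (real k).
        dist (entire_apply (V m (y k)) z) (entire_apply 0 z) < (1 / 2) ^ k"
      by (rule uniform_limitD) simp
    then obtain M where "\<forall>m\<ge>M. \<forall>z\<in>cball 0 (real k).
        dist (entire_apply (V m (y k)) z) (entire_apply 0 z) < (1 / 2) ^ k"
      unfolding eventually_sequentially by blast
    then have "\<forall>m\<ge>M. \<forall>z\<in>cball 0 (real k). norm (entire_apply (V m (y k)) z) \<le> (1 / 2) ^ k"
      by (simp add: entire_rep less_imp_le)
    then show ?thesis by blast
  qed
  then obtain M where M: "\<And>k m z. M k \<le> m \<Longrightarrow> z \<in> cball 0 (real k) \<Longrightarrow>
      norm (entire_apply (V m (y k)) z) \<le> (1 / 2) ^ k"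
    by metis

  text \<open>For \<open>i < k < j\<close> the gaps of \<open>n\<close> are so large that \<open>T ^^ n k\<close> annihilates the \<open>i\<close>-th term
    of the series \<open>\<Sum>k. V (n k) (y k)\<close>, sends the \<open>k\<close>-th one to \<open>V 0 (y k)\<close> and leaves the
    \<open>j\<close>-th one smaller than \<open>(1 / 2) ^ j\<close>.\<close>
  define n where "n k = (\<Sum>i\<le>k. M i) + (\<Sum>i<k. length (y i))" for k
  have n_Suc: "n (Suc k) = n k + M (Suc k) + length (y k)" for k
    by (simp add: n_def)
  have n_mono: "n i \<le> n j" if "i \<le> j" for i j
    by (rule lift_Suc_mono_le[OF _ that]) (simp add: n_Suc)
  have n_M: "M k \<le> n k" for k
    by (cases k) (auto simp: n_Suc, simp add: n_def)
  have n_gap: "n j + M k \<le> n k" if "j < k" for j k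
    using that n_mono[of j "k - 1"] n_Suc[of "k - 1"] by (cases k) simp_all
  have n_length: "n k + length (y k) \<le> n j" if "k < j" for j k
    using that n_mono[of "Suc k" j] n_Suc[of k] by simp

  obtain x where x: "(\<lambda>N. \<Sum>k<N. V (n k) (y k)) \<longlonglongrightarrow> x"
    by (rule entire_convergent_series[OF M[OF n_M]])
  have close: "norm (entire_apply ((T ^^ n j) x) z - entire_apply (V 0 (y j)) z) \<le> (1 / 2) ^ j"
    if z: "z \<in> cball 0 (real j)" for j z
  \<comment> \<open>The bound is proved for partial sums with \<open>N > j\<close>, where linearity
    applies, and passes to the limit by continuity of \<open>T ^^ n j\<close>.\<close>
  proof (rule Lim_norm_ubound)
    interpret Tn: Vector_Spaces.linear entire_scale entire_scale "T ^^ n j"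
      by (rule linear_funpow[OF lin])
    have "(\<lambda>N. (T ^^ n j) (\<Sum>k<N. V (n k) (y k))) \<longlonglongrightarrow> (T ^^ n j) x"
      by (rule continuous_on_tendsto_compose[OF continuous_on_funpow[OF cont] x]) auto
    from tendsto_entire_apply[OF this]
    show "(\<lambda>N. entire_apply ((T ^^ n j) (\<Sum>k<N. V (n k) (y k))) z - entire_apply (V 0 (y j)) z)
            \<longlonglongrightarrow> entire_apply ((T ^^ n j) x) z - entire_apply (V 0 (y j)) z"
      by (intro tendsto_diff tendsto_const)
    have "norm (entire_apply ((T ^^ n j) (\<Sum>k<N. V (n k) (y k))) z - entire_apply (V 0 (y j)) z) \<le> (1 / 2) ^ j"
      if N: "Suc j \<le> N" for N
    proof -
      have "(T ^^ n j) (\<Sum>k<N. V (n k) (y k)) = (\<Sum>k<N. (T ^^ n j) (V (n k) (y k)))"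
        by (simp add: Tn.sum)
      also have "\<dots> = (\<Sum>k=j..<N. (T ^^ n j) (V (n k) (y k)))"
        by (rule sum.mono_neutral_right) (auto intro!: TV_0 n_length)
      also have "\<dots> = (\<Sum>k=j..<N. V (n k - n j) (y k))"
        by (intro sum.cong refl TV_le n_mono) simp
      also have "\<dots> = V 0 (y j) + (\<Sum>k=Suc j..<N. V (n k - n j) (y k))"
        using N by (simp add: sum.atLeast_Suc_lessThan)
      finally have "entire_apply ((T ^^ n j) (\<Sum>k<N. V (n k) (y k))) z - entire_apply (V 0 (y j)) z
          = (\<Sum>k=Suc j..<N. entire_apply (V (n k - n j) (y k)) z)"
        by (simp add: entire_rep entire_apply_sum)
      also have "norm \<dots> \<le> (\<Sum>k=Suc j..<N. (1 / 2) ^ k)"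
      proof (rule sum_norm_le)
        fix k assume k: "k \<in> {Suc j..<N}"
        show "norm (entire_apply (V (n k - n j) (y k)) z) \<le> (1 / 2) ^ k"
          by (rule M) (use k z n_gap[of j k] in auto)
      qed
      also have "\<dots> \<le> (1 / 2) ^ j" by (rule sum_half_powers_le)
      finally show ?thesis .
    qed
    then show "\<forall>\<^sub>F N in sequentially. norm (entire_apply ((T ^^ n j) (\<Sum>k<N. V (n k) (y k))) z
        - entire_apply (V 0 (y j)) z) \<le> (1 / 2) ^ j"
      unfolding eventually_sequentially by blast
  qed simp

  have "g \<in> closure (range (\<lambda>n. (T ^^ n) x))" for g
    unfolding closure_entire_iff
  proof (intro allI impI)
    fix r e :: real assume r: "0 \<le> r" and e: "0 < e"
    have "g \<in> closure (V 0 ` lists D)" by (simp add: closure_V)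
    moreover have "0 < e / 2" using e by simp
    ultimately obtain cs where cs: "cs \<in> lists D"
      "\<forall>z\<in>cball 0 r. dist (entire_apply (V 0 cs) z) (entire_apply g z) < e / 2"
      using r unfolding closure_entire_iff by blast
    obtain m where m: "(1 / 2) ^ m < e / 2"
      using real_arch_pow_inv[of "e / 2" "1 / 2"] e by auto
    \<comment> \<open>A late recurrence of \<open>cs\<close>: \<open>j \<ge> m\<close> pushes the
      error below \<open>e / 2\<close>, and \<open>j \<ge> r\<close> makes \<open>close\<close>
      applicable on all of \<open>cball 0 r\<close>.\<close>
    obtain j where j: "max m (nat \<lceil>r\<rceil>) \<le> j" "y j = cs"
      using y_surj[OF cs(1)] by blast
    have "dist (entire_apply ((T ^^ n j) x) z) (entire_apply g z) < e" if z: "z \<in> cball 0 r" for z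
    proof -
      have "r \<le> real j" using j(1) by linarith
      with z have "z \<in> cball 0 (real j)" by simp
      from close[OF this] have "dist (entire_apply ((T ^^ n j) x) z) (entire_apply (V 0 cs) z) \<le> (1 / 2) ^ j"
        by (simp add: dist_norm j(2))
      also have "(1 / 2 :: real) ^ j \<le> (1 / 2) ^ m"
        using j(1) by (intro power_decreasing) auto
      also note m
      finally show ?thesis
        using cs(2) z dist_triangle_half_r[of "entire_apply (V 0 cs) z"] by (metis dist_commute)
    qed
    then show "\<exists>h\<in>range (\<lambda>n. (T ^^ n) x). \<forall>z\<in>cball 0 r. dist (entire_apply h z) (entire_apply g z) < e"
      by blast
  qed
  with lin cont show ?thesis
    unfolding hypercyclic_def by blast
qed

subsection \<open>The kernel of an operator with scalar commutator\<close>

lift_definition entire_shift :: "complex \<Rightarrow> entire \<Rightarrow> entire" is "\<lambda>w f z. f (w + z)"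
proof -
  fix w :: complex and f :: "complex \<Rightarrow> complex"
  assume "f holomorphic_on UNIV"
  then have "f \<circ> (+) w holomorphic_on UNIV"
    by (intro holomorphic_on_compose_gen[where t = UNIV] holomorphic_intros) auto
  then show "(\<lambda>z. f (w + z)) holomorphic_on UNIV"
    by (simp add: o_def)
qed

lemma uniform_limit_entire_taylor:
  assumes "0 \<le> r" "0 \<le> s"
  shows "uniform_limit (cball 0 r \<times> cball 0 s)
      (\<lambda>N (w, z). \<Sum>n<N. (deriv ^^ n) (entire_apply f) w / fact n * z ^ n)
      (\<lambda>(w, z). entire_apply f (w + z)) sequentially"
  using assms by (intro uniform_limit_taylor[where \<rho> = "r + s + 1"])
    (auto intro: holomorphic_on_subset[OF entire_apply_holomorphic])

text \<open>The Taylor expansion with varying centre \<open>z\<close> and fixed increment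
  \<open>w\<close>; formally, the shift is \<open>exp (w D)\<close> applied to
  \<open>f\<close>.\<close>

lemma tendsto_entire_shift:
  "(\<lambda>N. \<Sum>n<N. entire_scale (w ^ n / fact n) ((entire_deriv ^^ n) f)) \<longlonglongrightarrow> entire_shift w f"
proof (rule tendsto_entire_cballI)
  fix r :: real assume "0 \<le> r"
  from uniform_limit_compose'[OF uniform_limit_entire_taylor[OF this norm_ge_zero[of w]],
      of "\<lambda>z. (z, w)" "cball 0 r"]
  show "uniform_limit (cball 0 r) (\<lambda>N. entire_apply
      (\<Sum>n<N. entire_scale (w ^ n / fact n) ((entire_deriv ^^ n) f)))
      (entire_apply (entire_shift w f)) sequentially"
    by (simp add: entire_apply_sum[abs_def] entire_apply_higher_deriv entire_scale.rep_eq
        entire_shift.rep_eq Pi_def mult.commute add.commute)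
qed

text \<open>The terms of a convergent series are differences of consecutive partial sums.\<close>

lemma tendsto_normalized_higher_deriv:
  "(\<lambda>n. entire_scale (w ^ n / fact n) ((entire_deriv ^^ n) f)) \<longlonglongrightarrow> 0"
proof -
  let ?P = "\<lambda>N. \<Sum>n<N. entire_scale (w ^ n / fact n) ((entire_deriv ^^ n) f)"
  have "(\<lambda>n. ?P (Suc n) - ?P n) \<longlonglongrightarrow> entire_shift w f - entire_shift w f"
    by (intro tendsto_diff tendsto_entire_shift LIMSEQ_Suc[OF tendsto_entire_shift])
  then show ?thesis by simp
qed

text \<open>Since \<open>s\<close> and \<open>\<delta>\<close> do not depend on \<open>g\<close>, a
  family of functions that is uniformly small on \<open>cball 0 s\<close> can be treated at
  once.\<close>

lemma continuous_entire_functional_small: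
  assumes cont: "continuous_on UNIV T" and T0: "T 0 = 0" and e: "0 < e"
  obtains s \<delta> where "0 \<le> s" "0 < \<delta>"
    "\<And>g. (\<And>z. z \<in> cball 0 s \<Longrightarrow> norm (entire_apply g z) < \<delta>) \<Longrightarrow> norm (entire_apply (T g) c) < e"
proof -
  have "open (T -` entire_nbhd 0 {c} e)"
    by (intro open_vimage open_entire_nbhd cont) simp
  moreover have "0 \<in> T -` entire_nbhd 0 {c} e"
    using e by (simp add: T0 entire_nbhd_def)
  ultimately obtain K \<delta> where K: "compact K" "0 < \<delta>" "entire_nbhd 0 K \<delta> \<subseteq> T -` entire_nbhd 0 {c} e"
    unfolding open_entire_def by blast
  obtain s where s: "0 \<le> s" "K \<subseteq> cball 0 s"
    using K(1) by (rule compact_subset_cball_0)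
  have "norm (entire_apply (T g) c) < e"
    if "\<And>z. z \<in> cball 0 s \<Longrightarrow> norm (entire_apply g z) < \<delta>" for g
  proof -
    have "g \<in> entire_nbhd 0 K \<delta>"
      using that s(2) by (auto simp: entire_nbhd_def zero_entire.rep_eq)
    with K(3) show ?thesis
      by (auto simp: entire_nbhd_def zero_entire.rep_eq)
  qed
  with s(1) K(2) show ?thesis by (rule that)
qed

context
  fixes T :: "entire \<Rightarrow> entire" and a :: complex and f :: entire
  assumes linear: "Vector_Spaces.linear entire_scale entire_scale T"
    and cont: "continuous_on UNIV T"
    and commutator: "commutator T entire_deriv = (\<lambda>f. entire_scale a f)"
    and kernel: "T f = 0"
begin

interpretation T: Vector_Spaces.linear entire_scale entire_scale T
  by (rule linear)

interpretation D: Vector_Spaces.linear entire_scale entire_scale entire_deriv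
  by (rule linear_entire_deriv)

lemma T_deriv: "T (entire_deriv g) = entire_deriv (T g) + entire_scale a g"
  using fun_cong[OF commutator, of g] by (simp add: commutator_def algebra_simps)

text \<open>Each exchange of \<open>T\<close> with a differentiation contributes one term with
  factor \<open>a\<close>; what remains is a derivative of \<open>T f = 0\<close>.\<close>

lemma kernel_higher_deriv:
  "T ((entire_deriv ^^ Suc n) f) = entire_scale (of_nat (Suc n) * a) ((entire_deriv ^^ n) f)"
proof (induction n)
  case 0
  show ?case by (simp add: T_deriv kernel D.zero)
next
  case (Suc n)
  have "T ((entire_deriv ^^ Suc (Suc n)) f)
          = entire_deriv (T ((entire_deriv ^^ Suc n) f)) + entire_scale a ((entire_deriv ^^ Suc n) f)"
    by (simp add: T_deriv)
  also have "\<dots> = entire_scale (of_nat (Suc (Suc n)) * a) ((entire_deriv ^^ Suc n) f)"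
  proof -
    have "of_nat (Suc (Suc n)) * a = of_nat (Suc n) * a + a"
      by (simp add: algebra_simps)
    then show ?thesis
      unfolding Suc D.scale by (simp only: entire.scale_left_distrib) simp
  qed
  finally show ?case .
qed

text \<open>On the partial sums of \<open>exp (w D) f\<close>, \<open>T\<close> acts as
  multiplication by \<open>a * w\<close> up to a change of length, so the shift is an eigenvector or
  0; the value is read off at 0.\<close>

lemma kernel_shift: "entire_apply (T (entire_shift w f)) 0 = a * w * entire_apply f w"
proof -
  let ?P = "\<lambda>N. \<Sum>n<N. entire_scale (w ^ n / fact n) ((entire_deriv ^^ n) f)"
  \<comment> \<open>The term \<open>n = 0\<close> is killed by \<open>T f = 0\<close>, and
    reindexing the others loses exactly one summand.\<close>
  have "T (?P (Suc N)) = entire_scale (a * w) (?P N)" for N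
  proof -
    have "T (?P (Suc N)) = (\<Sum>n<N. entire_scale (w ^ Suc n / fact (Suc n)) (T ((entire_deriv ^^ Suc n) f)))"
      unfolding sum.lessThan_Suc_shift by (simp add: T.add T.sum T.scale kernel del: funpow.simps(2))
    also have "\<dots> = (\<Sum>n<N. entire_scale (a * w) (entire_scale (w ^ n / fact n) ((entire_deriv ^^ n) f)))"
    proof (rule sum.cong[OF refl])
      fix n
      have "w ^ Suc n / fact (Suc n) * (of_nat (Suc n) * a) = a * w * (w ^ n / fact n)"
        by (simp add: field_simps del: of_nat_Suc)
      then show "entire_scale (w ^ Suc n / fact (Suc n)) (T ((entire_deriv ^^ Suc n) f))
          = entire_scale (a * w) (entire_scale (w ^ n / fact n) ((entire_deriv ^^ n) f))"
        unfolding kernel_higher_deriv by simp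
    qed
    finally show ?thesis by (simp add: entire.scale_sum_right)
  qed
  moreover have "(\<lambda>N. T (?P (Suc N))) \<longlonglongrightarrow> T (entire_shift w f)"
    by (rule continuous_on_tendsto_compose[OF cont LIMSEQ_Suc[OF tendsto_entire_shift]]) auto
  ultimately have lim1: "(\<lambda>N. entire_scale (a * w) (?P N)) \<longlonglongrightarrow> T (entire_shift w f)"
    by simp
  have lim2: "(\<lambda>N. entire_scale (a * w) (?P N)) \<longlonglongrightarrow> entire_scale (a * w) (entire_shift w f)"
    by (intro tendsto_entire_scale tendsto_const tendsto_entire_shift)
  show ?thesis
    using LIMSEQ_unique[OF tendsto_entire_apply[OF lim1, of 0] tendsto_entire_apply[OF lim2, of 0]]
    by (simp add: entire_scale.rep_eq entire_shift.rep_eq)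
qed

text \<open>Expanding \<open>f (w + z)\<close> in powers of \<open>z\<close> instead of \<open>w\<close> expresses the eigenvalue identity
  \<open>kernel_shift\<close> as a limit, uniform in \<open>w\<close>, of linear combinations of derivatives of \<open>f\<close> at \<open>w\<close>.\<close>

lemma var_mult_mem_closure_span:
  assumes "a \<noteq> 0"
  shows "entire_var * f \<in> closure (entire.span (range (\<lambda>n. (entire_deriv ^^ n) f)))"
proof -
  let ?S = "entire.span (range (\<lambda>n. (entire_deriv ^^ n) f))"
  have "entire_scale a (entire_var * f) \<in> closure ?S"
    unfolding closure_entire_iff
  proof (intro allI impI)
    fix r e :: real assume r: "0 \<le> r" and e: "0 < e"
    obtain s \<delta> where s: "0 \<le> s" "0 < \<delta>"
      "\<And>g. (\<And>z. z \<in> cball 0 s \<Longrightarrow> norm (entire_apply g z) < \<delta>) \<Longrightarrow> norm (entire_apply (T g) 0) < e"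
      using continuous_entire_functional_small[OF cont T.zero e, of 0] by blast
    from uniform_limitD[OF uniform_limit_entire_taylor[OF r s(1), of f] s(2)]
    obtain N where N: "\<And>w z. w \<in> cball 0 r \<Longrightarrow> z \<in> cball 0 s \<Longrightarrow>
        dist (\<Sum>n<N. (deriv ^^ n) (entire_apply f) w / fact n * z ^ n) (entire_apply f (w + z)) < \<delta>"
      unfolding eventually_sequentially by force
    \<comment> \<open>\<open>g w\<close> is the value at 0 of \<open>T\<close> applied, in the
      variable \<open>z\<close>, to the Taylor polynomial of \<open>f (w + z)\<close>: by linearity
      the derivatives at \<open>w\<close> become the functions and the numbers
      \<open>T (z ^ n)\<close> at 0 the coefficients.\<close>
    define g where "g = (\<Sum>n<N. entire_scale (entire_apply (T (entire_var ^ n)) 0 / fact n)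
                                   ((entire_deriv ^^ n) f))"
    have "dist (entire_apply g w) (entire_apply (entire_scale a (entire_var * f)) w) < e"
      if w: "w \<in> cball 0 r" for w
    proof -
      define p where "p = (\<Sum>n<N. entire_scale ((deriv ^^ n) (entire_apply f) w / fact n) (entire_var ^ n))"
      have "norm (entire_apply (p - entire_shift w f) z) < \<delta>" if "z \<in> cball 0 s" for z
        using N[OF w that]
        by (simp add: p_def dist_norm minus_entire.rep_eq entire_apply_sum entire_scale.rep_eq
            entire_apply_power entire_var.rep_eq entire_shift.rep_eq)
      then have "norm (entire_apply (T (p - entire_shift w f)) 0) < e"
        by (rule s(3))
      moreover have "entire_apply (T p) 0 = entire_apply g w"
        by (simp add: p_def g_def T.sum T.scale entire_apply_sum entire_scale.rep_eq
            entire_apply_higher_deriv mult.commute)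
      ultimately show ?thesis
        by (simp add: T.diff dist_norm minus_entire.rep_eq kernel_shift entire_scale.rep_eq
            times_entire.rep_eq entire_var.rep_eq mult.assoc)
    qed
    moreover have "g \<in> ?S"
      unfolding g_def by (intro entire.span_sum entire.span_scale entire.span_base) auto
    ultimately show "\<exists>g\<in>?S. \<forall>z\<in>cball 0 r.
        dist (entire_apply g z) (entire_apply (entire_scale a (entire_var * f)) z) < e"
      by blast
  qed
  then have "entire_scale (1 / a) (entire_scale a (entire_var * f)) \<in> closure ?S"
    by (rule entire.subspace_scale[OF subspace_closure_entire[OF entire.subspace_span]])
  with assms show ?thesis by simp
qed

end

text \<open>Reduces invariance to the generators. Their images need only lie in the closure, as is
  the case for multiplication by \<open>z\<close>.\<close>

lemma closure_span_invariant:
  assumes lin: "Vector_Spaces.linear entire_scale entire_scale h"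
    and cont: "continuous_on UNIV h"
    and B: "\<And>b. b \<in> B \<Longrightarrow> h b \<in> closure (entire.span B)"
    and x: "x \<in> closure (entire.span B)"
  shows "h x \<in> closure (entire.span B)"
proof -
  interpret h: Vector_Spaces.linear entire_scale entire_scale h by fact
  have sub: "entire.subspace (closure (entire.span B))"
    by (intro subspace_closure_entire entire.subspace_span)
  have "h y \<in> closure (entire.span B)" if "y \<in> entire.span B" for y
    using that
  proof (induction rule: entire.span_induct_alt)
    case base
    show ?case by (simp add: h.zero entire.subspace_0[OF sub])
  next
    case (step c b y)
    show ?case
      unfolding h.add h.scale
      by (rule entire.subspace_add[OF sub entire.subspace_scale[OF sub B[OF step(1)]] step(2)])
  qed
  then have "h ` closure (entire.span B) \<subseteq> closure (entire.span B)"
    by (intro image_closure_subset[OF continuous_on_subset[OF cont]]) auto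
  with x show ?thesis by blast
qed

theorem theorem1p1:
  fixes T :: "entire \<Rightarrow> entire" and a :: complex
  assumes "Vector_Spaces.linear entire_scale entire_scale T"
    and "continuous_on UNIV T"
    and "{f. T f = 0} \<noteq> {0}"
    and "a \<noteq> 0"
    and "commutator T entire_deriv = (\<lambda>f. entire_scale a f)"
  shows "hypercyclic entire_scale T"
proof -
  interpret T: Vector_Spaces.linear entire_scale entire_scale T by fact
  interpret D: Vector_Spaces.linear entire_scale entire_scale entire_deriv
    by (rule linear_entire_deriv)
  obtain f where f: "T f = 0" "f \<noteq> 0"
    using assms(3) T.zero by blast
  note T_higher = kernel_higher_deriv[OF assms(1,2,5) f(1)]

  let ?B = "range (\<lambda>n. (entire_deriv ^^ n) f)"
  define E where "E = closure (entire.span ?B)"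
  have subspace: "entire.subspace E"
    unfolding E_def by (intro subspace_closure_entire entire.subspace_span)
  have B: "(entire_deriv ^^ n) f \<in> E" for n
    unfolding E_def by (intro subsetD[OF closure_subset] entire.span_base) auto
  have deriv: "entire_deriv g \<in> E" if "g \<in> E" for g
    using that unfolding E_def
  proof (rule closure_span_invariant[OF linear_entire_deriv, rotated 2])
    show "continuous_on UNIV entire_deriv"
      by (intro continuous_on_tendstoI tendsto_entire_deriv tendsto_ident_at)
    show "entire_deriv b \<in> closure (entire.span ?B)" if "b \<in> ?B" for b
      using that B[of "Suc _"] unfolding E_def by auto
  qed
  have var_f: "entire_var * f \<in> E"
    unfolding E_def by (rule var_mult_mem_closure_span[OF assms(1,2,5) f(1) assms(4)])
  \<comment> \<open>Leibniz's rule for the \<open>n\<close>-th derivative of \<open>z f\<close> is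
    solved for \<open>z\<close> times the \<open>n\<close>-th derivative of \<open>f\<close>; all
    other terms are known to lie in \<open>E\<close>.\<close>
  have "entire_var * (entire_deriv ^^ n) f \<in> E" for n
  proof (cases n)
    case 0
    with var_f show ?thesis by simp
  next
    case (Suc m)
    have "(entire_deriv ^^ k) (entire_var * f) \<in> E" for k
      by (induction k) (auto intro: var_f deriv)
    moreover have "of_nat k * g = entire_scale (of_nat k) g" for k g
      by (rule entire_eqI) (simp add: entire_rep entire_apply_of_nat)
    then have "of_nat (Suc m) * (entire_deriv ^^ m) f \<in> E"
      using entire.subspace_scale[OF subspace B] by metis
    ultimately have "(entire_deriv ^^ n) (entire_var * f) - of_nat (Suc m) * (entire_deriv ^^ m) f \<in> E"
      by (intro entire.subspace_diff subspace)
    then show ?thesis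
      unfolding Suc higher_entire_deriv_linear_mult[OF entire_deriv_var] by simp
  qed
  moreover have "Vector_Spaces.linear entire_scale entire_scale ((*) entire_var)"
    by (simp add: Vector_Spaces.linear_iff entire.vector_space_axioms algebra_simps entire_scale_eq_mult)
  moreover have "continuous_on UNIV ((*) entire_var)"
    by (intro continuous_on_tendstoI tendsto_entire_mult tendsto_const tendsto_ident_at)
  ultimately have var: "entire_var * g \<in> E" if "g \<in> E" for g
    using that closure_span_invariant[of "(*) entire_var" ?B g] unfolding E_def by blast
  have "closed E" "f \<in> E"
    using B[of 0] by (simp_all add: E_def)
  then have E: "E = UNIV"
    using deriv_invariant_closed_ideal_eq_UNIV[OF _ subspace var deriv _ f(2)] by blast

  \<comment> \<open>Dividing by \<open>n! a^n\<close> turns the weights \<open>(n + 1) a\<close>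
    into 1. These are the terms of the expansion of the shift by \<open>1 / a\<close>, hence a null
    sequence.\<close>
  define u where "u n = entire_scale ((1 / a) ^ n / fact n) ((entire_deriv ^^ n) f)" for n
  show ?thesis
  proof (rule hypercyclic_backward_shift)
    show "T (u 0) = 0"
      by (simp add: u_def f)
    show "T (u (Suc n)) = u n" for n
    proof -
      have "(1 / a) ^ Suc n / fact (Suc n) * (of_nat (Suc n) * a) = (1 / a) ^ n / fact n"
        using assms(4) by (simp add: field_simps del: of_nat_Suc)
      then show ?thesis
        unfolding u_def T.scale T_higher by simp
    qed
    show "u \<longlonglongrightarrow> 0"
      unfolding u_def by (rule tendsto_normalized_higher_deriv)
    have "(entire_deriv ^^ n) f \<in> entire.span (range u)" for n
    proof -
      have "(entire_deriv ^^ n) f = entire_scale (fact n * a ^ n) (u n)"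
        using assms(4) by (simp add: u_def power_divide)
      also have "\<dots> \<in> entire.span (range u)"
        by (intro entire.span_scale entire.span_base) simp
      finally show ?thesis .
    qed
    then have "entire.span ?B \<subseteq> entire.span (range u)"
      by (intro entire.span_minimal entire.subspace_span) auto
    from closure_mono[OF this] E show "closure (entire.span (range u)) = UNIV"
      unfolding E_def by auto
  qed (fact assms)+
qed

end
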